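(* Let $b(x)$ and $\sigma(x)$ be smooth $2\pi$-periodic real functions satisfying $|b(x)|\le b_1<1$ and $0<\sigma_0\le\sigma(x)\le\sigma_1$ for all $x\in[0,2\pi]$, where $b_1,\sigma_0,\sigma_1$ are constants. Let $0\le T_0\le T<\infty$ and let $c_{CFL}>0$ be any constant. There is a constant $C$, independent of $\varepsilon$, $\Delta t$ and $N$, such that for every $\varepsilon>0$, every integer $N\ge1$ and every $\Delta t>0$ with $\Delta t\le\min\{c_{CFL}/N^2,1\}$, the sequence $(\tilde U_N^n,W_N^n)_{n\ge0}$ in $\mathbb{P}_N$ generated from starting values $\tilde U_N^0,W_N^0\in\mathbb{P}_N$ by the scheme $$\begin{aligned}&\tilde U_N^{n+1}-\tilde U_N^n+\Delta t\,\mathcal{P}_N\left(\partial_x(b\tilde U_N^n)+\frac{b^2\partial_xb}{1-b^2}\tilde U_N^n+\sqrt{1-b^2}\,\partial_xW_N^n\right)=0,\\ &W_N^{n+1}-W_N^n+\Delta t\,\mathcal{P}_N\left[\partial_x\big(\sqrt{1-b^2}\,\tilde U_N^n\big)+\frac{b\,\partial_xb}{\sqrt{1-b^2}}\tilde U_N^n-b\,\partial_xW_N^n\right]=-\frac{\Delta t}{\varepsilon}\mathcal{P}_N\big(\sigma W_N^{n+1}\big),\qquad n\ge0,\end{aligned}$$ satisfies $$\|\tilde U_N^n\|^2+\|W_N^n\|^2\le C\left(\|\tilde U_N^0\|^2+\|W_N^0\|^2\right)$$ for every $n\ge0$ such that $t_n=T_0+n\Delta t\le T$.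
   Context: $\mathbb{P}_N=\mathrm{span}\{e^{ikx}:-N\le k\le N\}$ is the (complex) space of trigonometric polynomials of degree at most $N$ on $[0,2\pi]$, $\|\cdot\|$ is the $L^2$ norm in $x$ over $[0,2\pi]$, and $\mathcal{P}_N$ is the Fourier projection $\mathcal{P}_Nf=\sum_{k=-N}^N\hat f_ke^{ikx}$, $\hat f_k=\frac1{2\pi}\int_0^{2\pi}f(x)e^{-ikx}\,dx$. The scheme is the first order IMEX-BDF (forward-backward Euler) scheme with Fourier-Galerkin discretization for the system $\partial_tu+\partial_xv=0$, $\partial_tv+\partial_xu=\frac{\sigma(x)}{\varepsilon}(b(x)u-v)$ rewritten in the variables $\tilde u=\sqrt{1-b^2}\,u$, $w=v-bu$. The constant $C$ may depend on the functions $b,\sigma$ and on $c_{CFL},T$. *)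

theory Defs
  imports "HOL-Analysis.Analysis"
begin

definition smooth_fun :: "(real \<Rightarrow> real) \<Rightarrow> bool" where
  "smooth_fun f \<longleftrightarrow> (\<forall>k x. (deriv ^^ k) f differentiable (at x))"

definition periodic_2pi :: "(real \<Rightarrow> 'a) \<Rightarrow> bool" where
  "periodic_2pi f \<longleftrightarrow> (\<forall>x. f (x + 2 * pi) = f x)"

definition fourier_mode :: "int \<Rightarrow> real \<Rightarrow> complex" where
  "fourier_mode k x = exp (\<i> * of_int k * of_real x)"

text \<open>Trigonometric polynomials are represented by their \<open>2\<pi>\<close>-periodic extensions to the whole
  real line, so that derivatives at the end points of \<open>[0, 2\<pi>]\<close> are ordinary two-sided ones.\<close>

definition trig_polys :: "nat \<Rightarrow> (real \<Rightarrow> complex) set" where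
  "trig_polys N = {f. \<exists>c. \<forall>x. f x = (\<Sum>k\<in>{- int N..int N}. c k * fourier_mode k x)}"

definition fourier_coeff :: "(real \<Rightarrow> complex) \<Rightarrow> int \<Rightarrow> complex" where
  "fourier_coeff f k =
     1 / (2 * of_real pi) * integral {0..2 * pi} (\<lambda>x. f x * exp (- (\<i> * of_int k * of_real x)))"

definition fourier_proj :: "nat \<Rightarrow> (real \<Rightarrow> complex) \<Rightarrow> real \<Rightarrow> complex" where
  "fourier_proj N f x = (\<Sum>k\<in>{- int N..int N}. fourier_coeff f k * fourier_mode k x)"

definition norm_L2 :: "(real \<Rightarrow> complex) \<Rightarrow> real" where
  "norm_L2 f = sqrt (integral {0..2 * pi} (\<lambda>x. (cmod (f x))\<^sup>2))"

abbreviation ddx :: "(real \<Rightarrow> complex) \<Rightarrow> real \<Rightarrow> complex" where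
  "ddx f x \<equiv> vector_derivative f (at x)"

text \<open>\<open>U\<close> is the variable \<open>sqrt (1 - b\<^sup>2) u\<close> and \<open>W\<close> is \<open>v - b u\<close>. The flux terms are explicit; only
  the relaxation term, which contains \<open>W (Suc n)\<close>, is implicit.\<close>

definition imex_bdf1_solution ::
  "(real \<Rightarrow> real) \<Rightarrow> (real \<Rightarrow> real) \<Rightarrow> real \<Rightarrow> real \<Rightarrow> nat \<Rightarrow>
   (nat \<Rightarrow> real \<Rightarrow> complex) \<Rightarrow> (nat \<Rightarrow> real \<Rightarrow> complex) \<Rightarrow> bool" where
  "imex_bdf1_solution b \<sigma> \<epsilon> dt N U W \<longleftrightarrow>
     (\<forall>n. U n \<in> trig_polys N \<and> W n \<in> trig_polys N) \<and>
     (\<forall>n x.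
        U (Suc n) x - U n x
        + of_real dt * fourier_proj N (\<lambda>y.
              ddx (\<lambda>z. of_real (b z) * U n z) y
            + of_real ((b y)\<^sup>2 * deriv b y / (1 - (b y)\<^sup>2)) * U n y
            + of_real (sqrt (1 - (b y)\<^sup>2)) * ddx (W n) y) x
        = 0) \<and>
     (\<forall>n x.
        W (Suc n) x - W n x
        + of_real dt * fourier_proj N (\<lambda>y.
              ddx (\<lambda>z. of_real (sqrt (1 - (b z)\<^sup>2)) * U n z) y
            + of_real (b y * deriv b y / sqrt (1 - (b y)\<^sup>2)) * U n y
            - of_real (b y) * ddx (W n) y) x
        = - of_real (dt / \<epsilon>) * fourier_proj N (\<lambda>y. of_real (\<sigma> y) * W (Suc n) y) x)"

end

theory Submission
  imports Defs
begin

text \<open>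
  The proof is an energy estimate for \<open>E\<^sub>n = \<parallel>U\<^sub>n\<parallel>\<^sup>2 + \<parallel>W\<^sub>n\<parallel>\<^sup>2\<close>: one step of the scheme gives
  \<open>E\<^sub>n\<^sub>+\<^sub>1 \<le> (1 + K \<Delta>t) E\<^sub>n\<close> with a constant \<open>K\<close> that depends only on \<open>b\<close> and on the CFL constant, so
  that \<open>E\<^sub>n \<le> exp (K T) E\<^sub>0\<close>.

  The implicit relaxation term drops out: testing the second equation with \<open>W\<^sub>n\<^sub>+\<^sub>1\<close> produces the
  dissipation \<open>(\<Delta>t/\<epsilon>) \<integral> \<sigma> \<bar>W\<^sub>n\<^sub>+\<^sub>1\<bar>\<^sup>2 \<ge> 0\<close>, so \<open>W\<^sub>n\<^sub>+\<^sub>1\<close> is no larger than the purely explicit update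
  (\<open>implicit_damping_energy\<close>). This is what makes the bound uniform in \<open>\<epsilon>\<close>. What is left is the
  forward Euler method for two fluxes \<open>A\<^sub>1, A\<^sub>2\<close>, for which (\<open>projected_euler_energy\<close>)
  \<open>E\<^sub>n\<^sub>+\<^sub>1 \<le> E\<^sub>n - 2 \<Delta>t (\<langle>A\<^sub>1, U\<rangle> + \<langle>A\<^sub>2, W\<rangle>) + \<Delta>t\<^sup>2 (\<parallel>A\<^sub>1\<parallel>\<^sup>2 + \<parallel>A\<^sub>2\<parallel>\<^sup>2)\<close>,
  because the projection is orthogonal.

  With \<open>s = sqrt (1 - b\<^sup>2)\<close> and \<open>m = b' / (1 - b\<^sup>2)\<close> the product rule turns the fluxes into
  \<open>A\<^sub>1 = m U + b U\<^sub>x + s W\<^sub>x\<close> and \<open>A\<^sub>2 = s U\<^sub>x - b W\<^sub>x\<close>. The matrix with rows \<open>(b, s)\<close> and \<open>(s, -b)\<close> is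
  symmetric and, since \<open>b\<^sup>2 + s\<^sup>2 = 1\<close>, orthogonal; each property controls one of the two flux terms.
  By symmetry the first-order part of \<open>A\<^sub>1 \<bullet> U + A\<^sub>2 \<bullet> W\<close> is a total derivative up to terms without
  derivatives of \<open>U\<close> and \<open>W\<close>, and the derivative integrates to zero by periodicity
  (\<open>flux_inner_bound\<close>). By orthogonality \<open>\<parallel>A\<^sub>1\<parallel>\<^sup>2 + \<parallel>A\<^sub>2\<parallel>\<^sup>2\<close> is bounded by a multiple of
  \<open>E\<^sub>n + \<parallel>U\<^sub>x\<parallel>\<^sup>2 + \<parallel>W\<^sub>x\<parallel>\<^sup>2\<close>, hence by a multiple of \<open>(1 + N\<^sup>2) E\<^sub>n\<close> with Bernstein's inequality
  (\<open>flux_norm_bound\<close>). As \<open>\<Delta>t \<le> 1\<close> and \<open>\<Delta>t N\<^sup>2 \<le> c\<close>, also \<open>\<Delta>t\<^sup>2 (1 + N\<^sup>2) \<le> (1 + c) \<Delta>t\<close>, so this term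
  contributes only \<open>O(\<Delta>t) E\<^sub>n\<close>.
\<close>

section \<open>The Fourier projection on continuous functions\<close>

text \<open>The real part of the Hermitian inner product: energies are real quadratic forms, and only
  the real part enters their expansion.\<close>

definition inner_L2 :: "(real \<Rightarrow> complex) \<Rightarrow> (real \<Rightarrow> complex) \<Rightarrow> real" where
  "inner_L2 f g = integral {0..2 * pi} (\<lambda>x. f x \<bullet> g x)"

lemma fourier_mode_has_vector_derivative:
  "(fourier_mode k has_vector_derivative \<i> * of_int k * fourier_mode k x) (at x within S)"
proof -
  have "((\<lambda>z. exp (\<i> * of_int k * z)) has_field_derivative \<i> * of_int k * exp (\<i> * of_int k * of_real x))
      (at (of_real x))"
    by (auto intro!: derivative_eq_intros)
  from has_vector_derivative_real_field[OF this] show ?thesis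
    by (simp add: fourier_mode_def[abs_def])
qed

lemma continuous_on_fourier_mode: "continuous_on S (fourier_mode k)"
  unfolding fourier_mode_def[abs_def] by (intro continuous_intros)

lemma fourier_mode_periodic: "fourier_mode k (x + 2 * pi) = fourier_mode k x"
proof -
  have "\<i> * of_int k * of_real (x + 2 * pi)
      = \<i> * of_int k * of_real x + \<i> * (of_int k * (of_real pi * 2))"
    by (simp add: algebra_simps)
  then show ?thesis
    unfolding fourier_mode_def by (simp add: exp_add exp_integer_2pi[of "of_int k"] exp_eq_1)
qed

lemma integral_fourier_mode:
  "integral {0..2 * pi} (fourier_mode k) = (if k = 0 then 2 * of_real pi else 0)"
proof (cases "k = 0")
  case True
  then show ?thesis by (simp add: fourier_mode_def[abs_def] scaleR_conv_of_real)
next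
  case False
  have "((\<lambda>x. fourier_mode k x / (\<i> * of_int k)) has_vector_derivative fourier_mode k x)
      (at x within {0..2 * pi})" for x
    using has_vector_derivative_divide[OF fourier_mode_has_vector_derivative[of k x "{0..2 * pi}"],
        of "\<i> * of_int k"] False by simp
  then have "(fourier_mode k has_integral
      fourier_mode k (2 * pi) / (\<i> * of_int k) - fourier_mode k 0 / (\<i> * of_int k)) {0..2 * pi}"
    by (intro fundamental_theorem_of_calculus) auto
  then show ?thesis
    using False fourier_mode_periodic[of k 0] by (simp add: integral_unique)
qed

lemma fourier_coeff_trig_poly:
  assumes "k \<in> {- int N..int N}"
  shows "fourier_coeff (\<lambda>x. \<Sum>j\<in>{- int N..int N}. c j * fourier_mode j x) k = c k"
proof -
  have "(\<lambda>x. (\<Sum>j\<in>{- int N..int N}. c j * fourier_mode j x) * exp (- (\<i> * of_int k * of_real x)))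
     = (\<lambda>x. \<Sum>j\<in>{- int N..int N}. c j * fourier_mode (j - k) x)"
    by (auto simp: fun_eq_iff fourier_mode_def sum_distrib_right ring_distribs mult.assoc
        simp flip: exp_add intro!: sum.cong)
  moreover have "integral {0..2 * pi} (\<lambda>x. \<Sum>j\<in>{- int N..int N}. c j * fourier_mode (j - k) x)
      = (\<Sum>j\<in>{- int N..int N}. c j * (if j = k then 2 * of_real pi else 0))"
    by (subst integral_sum)
      (auto intro!: integrable_continuous_interval continuous_intros continuous_on_fourier_mode sum.cong
        simp: integral_fourier_mode)
  moreover have "\<dots> = c k * (2 * of_real pi)"
    using assms by (simp add: if_distrib[of "(*) _"] sum.delta' cong: if_cong)
  ultimately show ?thesis
    by (simp add: fourier_coeff_def)
qed

text \<open>Testing with a trigonometric polynomial sees only the Fourier coefficients of index at most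
  \<open>N\<close>. Both the orthogonality of the projection and Parseval's identity follow from this.\<close>

lemma inner_L2_trig_poly:
  assumes f: "continuous_on {0..2 * pi} f"
  shows "inner_L2 f (\<lambda>x. \<Sum>k\<in>{- int N..int N}. c k * fourier_mode k x)
    = 2 * pi * Re (\<Sum>k\<in>{- int N..int N}. fourier_coeff f k * cnj (c k))"
proof -
  let ?e = "\<lambda>k x. exp (- (\<i> * of_int k * of_real x)) :: complex"
  have int: "(\<lambda>x. f x * ?e k x) integrable_on {0..2 * pi}" for k
    by (intro integrable_continuous_interval continuous_intros f)
  have inner: "z \<bullet> w = Re (z * cnj w)" for z w :: complex
    by (simp add: inner_complex_def)
  have cnj: "cnj (fourier_mode k x) = ?e k x" for k x
    by (simp add: fourier_mode_def exp_cnj)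
  have "(\<lambda>x. f x \<bullet> (\<Sum>k\<in>{- int N..int N}. c k * fourier_mode k x))
      = (\<lambda>x. Re (\<Sum>k\<in>{- int N..int N}. cnj (c k) * (f x * ?e k x)))"
    by (simp add: inner cnj sum_distrib_left mult_ac)
  moreover have "((\<lambda>x. \<Sum>k\<in>{- int N..int N}. cnj (c k) * (f x * ?e k x)) has_integral
      (\<Sum>k\<in>{- int N..int N}. cnj (c k) * (2 * of_real pi * fourier_coeff f k))) {0..2 * pi}"
    using int by (intro has_integral_sum has_integral_mult_right)
      (auto simp: fourier_coeff_def intro: integrable_integral)
  from has_integral_linear[OF this bounded_linear_Re]
  have "integral {0..2 * pi} (\<lambda>x. Re (\<Sum>k\<in>{- int N..int N}. cnj (c k) * (f x * ?e k x)))
      = Re (\<Sum>k\<in>{- int N..int N}. cnj (c k) * (2 * of_real pi * fourier_coeff f k))"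
    by (simp add: o_def integral_unique)
  moreover have "(\<Sum>k\<in>{- int N..int N}. cnj (c k) * (2 * of_real pi * fourier_coeff f k))
      = of_real (2 * pi) * (\<Sum>k\<in>{- int N..int N}. fourier_coeff f k * cnj (c k))"
    by (simp add: sum_distrib_left mult_ac)
  ultimately show ?thesis
    unfolding inner_L2_def by (simp del: of_real_mult)
qed

lemma continuous_on_trig_poly: "p \<in> trig_polys N \<Longrightarrow> continuous_on S p"
proof -
  assume "p \<in> trig_polys N"
  then obtain c where "p = (\<lambda>x. \<Sum>k\<in>{- int N..int N}. c k * fourier_mode k x)"
    by (auto simp: trig_polys_def)
  then show ?thesis
    by (simp, intro continuous_intros continuous_on_fourier_mode)
qed

lemma trig_poly_periodic: "p \<in> trig_polys N \<Longrightarrow> p (x + 2 * pi) = p x"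
  by (auto simp: trig_polys_def fourier_mode_periodic)

lemma fourier_proj_in_trig_polys: "fourier_proj N f \<in> trig_polys N"
  by (auto simp: trig_polys_def fourier_proj_def)

lemma inner_L2_commute: "inner_L2 f g = inner_L2 g f"
  by (simp add: inner_L2_def inner_commute)

text \<open>The projection and the function have the same coefficients of index at most \<open>N\<close>.\<close>

lemma inner_L2_fourier_proj:
  assumes f: "continuous_on {0..2 * pi} f" and p: "p \<in> trig_polys N"
  shows "inner_L2 (fourier_proj N f) p = inner_L2 f p"
proof -
  obtain c where c: "p = (\<lambda>x. \<Sum>k\<in>{- int N..int N}. c k * fourier_mode k x)"
    using p by (auto simp: trig_polys_def)
  have "fourier_coeff (fourier_proj N f) k = fourier_coeff f k" if "k \<in> {- int N..int N}" for k
    unfolding fourier_proj_def[abs_def] by (rule fourier_coeff_trig_poly[OF that])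
  then have "(\<Sum>k\<in>{- int N..int N}. fourier_coeff (fourier_proj N f) k * cnj (c k))
      = (\<Sum>k\<in>{- int N..int N}. fourier_coeff f k * cnj (c k))"
    by (intro sum.cong) auto
  then show ?thesis
    unfolding c
    using inner_L2_trig_poly[OF continuous_on_trig_poly[OF fourier_proj_in_trig_polys[of N f]],
        where N = N and c = c]
      inner_L2_trig_poly[OF f, where N = N and c = c] by simp
qed

text \<open>For a non-integrable square both sides are \<open>0\<close>, the default value of the integral.\<close>

lemma norm_L2_power2: "(norm_L2 f)\<^sup>2 = inner_L2 f f"
proof -
  have "0 \<le> integral {0..2 * pi} (\<lambda>x. (cmod (f x))\<^sup>2)"
    by (cases "(\<lambda>x. (cmod (f x))\<^sup>2) integrable_on {0..2 * pi}")
      (auto intro: integral_nonneg simp: not_integrable_integral)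
  then show ?thesis
    by (simp add: norm_L2_def inner_L2_def power2_norm_eq_inner)
qed

lemma inner_L2_add_left:
  assumes "continuous_on {0..2 * pi} f" "continuous_on {0..2 * pi} g" "continuous_on {0..2 * pi} h"
  shows "inner_L2 (\<lambda>x. f x + g x) h = inner_L2 f h + inner_L2 g h"
  unfolding inner_L2_def inner_add_left
  by (intro integral_add integrable_continuous_interval continuous_intros assms)

lemma inner_L2_scale_left: "inner_L2 (\<lambda>x. of_real r * f x) g = r * inner_L2 f g"
  by (simp add: inner_L2_def flip: scaleR_conv_of_real)

lemma inner_L2_scale_right: "inner_L2 f (\<lambda>x. of_real r * g x) = r * inner_L2 f g"
  by (simp add: inner_L2_def flip: scaleR_conv_of_real)

lemma inner_L2_add_right:
  assumes "continuous_on {0..2 * pi} f" "continuous_on {0..2 * pi} g" "continuous_on {0..2 * pi} h"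
  shows "inner_L2 h (\<lambda>x. f x + g x) = inner_L2 h f + inner_L2 h g"
  using inner_L2_add_left[OF assms] by (simp add: inner_L2_commute)

lemma inner_L2_nonneg: "inner_L2 f f \<ge> 0"
  by (simp flip: norm_L2_power2)

lemma two_inner_L2_le:
  assumes f: "continuous_on {0..2 * pi} f" and g: "continuous_on {0..2 * pi} g"
  shows "2 * inner_L2 f g \<le> inner_L2 f f + inner_L2 g g"
proof -
  have "0 \<le> inner_L2 (\<lambda>x. f x + of_real (-1) * g x) (\<lambda>x. f x + of_real (-1) * g x)"
    by (rule inner_L2_nonneg)
  also have "\<dots> = inner_L2 f f - 2 * inner_L2 f g + inner_L2 g g"
    using f g by (simp only: inner_L2_add_left inner_L2_add_right inner_L2_scale_left
        inner_L2_scale_right continuous_intros) (simp add: inner_L2_commute[of g f])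
  finally show ?thesis by simp
qed

text \<open>Bessel's inequality in the form \<open>\<parallel>P f\<parallel>\<^sup>2 = \<langle>f, P f\<rangle> \<le> (\<parallel>f\<parallel>\<^sup>2 + \<parallel>P f\<parallel>\<^sup>2) / 2\<close>.\<close>

lemma inner_L2_fourier_proj_le:
  assumes f: "continuous_on {0..2 * pi} f"
  shows "inner_L2 (fourier_proj N f) (fourier_proj N f) \<le> inner_L2 f f"
  using two_inner_L2_le[OF f continuous_on_trig_poly[OF fourier_proj_in_trig_polys, of _ N f]]
    inner_L2_fourier_proj[OF f fourier_proj_in_trig_polys[of N f]] by simp

text \<open>Differentiation multiplies the \<open>k\<close>-th coefficient by \<open>i k\<close>, of modulus at most \<open>N\<close>; with
  Parseval's identity this is Bernstein's inequality in \<open>L\<^sup>2\<close>, the last claim.\<close>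

lemma trig_poly_derivative:
  assumes p: "p \<in> trig_polys N"
  shows "(p has_vector_derivative ddx p x) (at x within S)"
    and "ddx p \<in> trig_polys N"
    and "inner_L2 (ddx p) (ddx p) \<le> (real N)\<^sup>2 * inner_L2 p p"
proof -
  obtain c where c: "p = (\<lambda>x. \<Sum>k\<in>{- int N..int N}. c k * fourier_mode k x)"
    using p by (auto simp: trig_polys_def)
  have deriv: "(p has_vector_derivative (\<Sum>k\<in>{- int N..int N}. \<i> * of_int k * c k * fourier_mode k x))
      (at x within S)" for x S
    unfolding c
    by (rule has_vector_derivative_sum)
      (rule has_vector_derivative_eq_rhs[OF
          has_vector_derivative_mult_right[OF fourier_mode_has_vector_derivative]], simp add: mult_ac)
  then have ddx: "ddx p = (\<lambda>x. \<Sum>k\<in>{- int N..int N}. \<i> * of_int k * c k * fourier_mode k x)"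
    by (auto intro!: vector_derivative_at)
  show "(p has_vector_derivative ddx p x) (at x within S)"
    using deriv[of x S] by (simp only: fun_cong[OF ddx])
  show in_polys: "ddx p \<in> trig_polys N"
    unfolding trig_polys_def ddx by (rule CollectI, rule exI[of _ "\<lambda>k. \<i> * of_int k * c k"]) simp
  have Parseval: "inner_L2 q q = 2 * pi * (\<Sum>k\<in>{- int N..int N}. (cmod (d k))\<^sup>2)"
    if q: "q = (\<lambda>x. \<Sum>k\<in>{- int N..int N}. d k * fourier_mode k x)" for q d
  proof -
    have "q \<in> trig_polys N" by (auto simp: q trig_polys_def)
    then have "inner_L2 q (\<lambda>x. \<Sum>k\<in>{- int N..int N}. d k * fourier_mode k x)
        = 2 * pi * Re (\<Sum>k\<in>{- int N..int N}. fourier_coeff q k * cnj (d k))"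
      by (intro inner_L2_trig_poly continuous_on_trig_poly)
    also have "(\<Sum>k\<in>{- int N..int N}. fourier_coeff q k * cnj (d k))
        = (\<Sum>k\<in>{- int N..int N}. of_real ((cmod (d k))\<^sup>2))"
      unfolding q by (intro sum.cong refl) (simp add: fourier_coeff_trig_poly complex_norm_square
          del: of_real_power)
    finally show ?thesis by (simp flip: q)
  qed
  have "(cmod (\<i> * of_int k * c k))\<^sup>2 \<le> (real N)\<^sup>2 * (cmod (c k))\<^sup>2" if "k \<in> {- int N..int N}" for k
  proof -
    have "\<bar>real_of_int k\<bar> \<le> real N" using that by (auto simp: abs_le_iff)
    then have "(real_of_int k)\<^sup>2 \<le> (real N)\<^sup>2" by (simp add: abs_le_square_iff[symmetric])
    then show ?thesis by (auto simp: norm_mult power_mult_distrib intro!: mult_right_mono)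
  qed
  then have "(\<Sum>k\<in>{- int N..int N}. (cmod (\<i> * of_int k * c k))\<^sup>2)
      \<le> (real N)\<^sup>2 * (\<Sum>k\<in>{- int N..int N}. (cmod (c k))\<^sup>2)"
    unfolding sum_distrib_left by (rule sum_mono)
  then show "inner_L2 (ddx p) (ddx p) \<le> (real N)\<^sup>2 * inner_L2 p p"
    unfolding Parseval[OF ddx] Parseval[OF c] by (simp add: mult.left_commute)
qed

section \<open>One step of a projected forward-backward Euler scheme\<close>

text \<open>Expanding the square, the projection disappears from the cross term because \<open>p\<close> lies in its
  range, and from the quadratic term because it is a contraction.\<close>

lemma projected_euler_energy:
  assumes p: "p \<in> trig_polys N" and f: "continuous_on {0..2 * pi} f" 
    and q: "\<And>x. q x = p x - of_real dt * fourier_proj N f x"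
  shows "inner_L2 q q \<le> inner_L2 p p - 2 * dt * inner_L2 f p + dt\<^sup>2 * inner_L2 f f"
proof -
  let ?P = "fourier_proj N f"
  have q': "q = (\<lambda>x. p x + of_real (- dt) * ?P x)"
    using q by auto
  have "continuous_on {0..2 * pi} p" "continuous_on {0..2 * pi} ?P"
    using continuous_on_trig_poly p fourier_proj_in_trig_polys by blast+
  then have "inner_L2 q q = inner_L2 p p - 2 * dt * inner_L2 ?P p + dt\<^sup>2 * inner_L2 ?P ?P"
    unfolding q' by (simp only: inner_L2_add_left inner_L2_add_right inner_L2_scale_left
        inner_L2_scale_right continuous_intros)
      (simp add: inner_L2_commute[of p ?P] power2_eq_square algebra_simps)
  then show ?thesis
    using mult_left_mono[OF inner_L2_fourier_proj_le[OF f, of N], of "dt\<^sup>2"]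
    by (simp add: inner_L2_fourier_proj[OF f p])
qed

text \<open>Here \<open>q\<close> is the implicit update of \<open>p\<close> under damping by \<open>\<sigma> \<ge> 0\<close>. Testing the equation with
  \<open>q\<close> gives \<open>\<parallel>q\<parallel>\<^sup>2 \<le> \<langle>p, q\<rangle>\<close> for every damping strength \<open>r\<close>.\<close>

lemma implicit_damping_energy:
  assumes q: "q \<in> trig_polys N" and p: "p \<in> trig_polys N" and r: "r \<ge> 0"
    and \<sigma>: "continuous_on {0..2 * pi} \<sigma>" "\<And>x. x \<in> {0..2 * pi} \<Longrightarrow> 0 \<le> \<sigma> x"
    and eq: "\<And>x. p x = q x + of_real r * fourier_proj N (\<lambda>y. of_real (\<sigma> y) * q y) x"
  shows "inner_L2 q q \<le> inner_L2 p p"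
proof -
  let ?P = "fourier_proj N (\<lambda>y. of_real (\<sigma> y) * q y)"
  have cont: "continuous_on {0..2 * pi} p" "continuous_on {0..2 * pi} q" "continuous_on {0..2 * pi} ?P"
    using continuous_on_trig_poly p q fourier_proj_in_trig_polys by blast+
  have p': "p = (\<lambda>x. q x + of_real r * ?P x)"
    using eq by auto
  have "inner_L2 p q = inner_L2 q q + r * inner_L2 ?P q"
    unfolding p' by (simp only: inner_L2_add_left inner_L2_scale_left continuous_intros cont)
  also have "inner_L2 ?P q = integral {0..2 * pi} (\<lambda>x. \<sigma> x * (q x \<bullet> q x))"
    by (subst inner_L2_fourier_proj)
      (auto simp: inner_L2_def q simp flip: scaleR_conv_of_real intro!: continuous_intros \<sigma> cont)
  finally have inner_eq: "inner_L2 p q = inner_L2 q q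
      + r * integral {0..2 * pi} (\<lambda>x. \<sigma> x * (q x \<bullet> q x))" .
  have "integral {0..2 * pi} (\<lambda>x. \<sigma> x * (q x \<bullet> q x)) \<ge> 0"
    by (rule integral_nonneg) (auto intro!: integrable_continuous_interval
        continuous_intros \<sigma> cont mult_nonneg_nonneg)
  then have "inner_L2 q q \<le> inner_L2 p q"
    using r by (simp add: inner_eq)
  then show ?thesis
    using two_inner_L2_le[OF cont(1,2)] by simp
qed


section \<open>The flux terms\<close>

text \<open>The condition \<open>\<bar>b\<bar> < 1\<close> is the subcharacteristic condition of the relaxation system; it makes
  \<open>1 - b\<^sup>2\<close> positive, so that \<open>s\<close> and \<open>m\<close> below are continuous.\<close>

locale subcharacteristic =
  fixes b :: "real \<Rightarrow> real"
  assumes b_deriv: "(b has_real_derivative deriv b x) (at x within S)"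
    and continuous_deriv_b: "continuous_on S (deriv b)"
    and b_less_1: "\<bar>b x\<bar> < 1"
    and b_endpoints: "b (2 * pi) = b 0"
begin

definition s :: "real \<Rightarrow> real" where
  "s x = sqrt (1 - (b x)\<^sup>2)"

text \<open>The coefficient of the undifferentiated \<open>U\<close> in the flux. Also \<open>b' = m s\<^sup>2\<close> and
  \<open>s' = - b m s\<close>, so a bound on \<open>m\<close> alone controls all the coefficient derivatives.\<close>

definition m :: "real \<Rightarrow> real" where
  "m x = deriv b x / (1 - (b x)\<^sup>2)"

definition U_flux :: "(real \<Rightarrow> complex) \<Rightarrow> (real \<Rightarrow> complex) \<Rightarrow> real \<Rightarrow> complex" where
  "U_flux U W y = ddx (\<lambda>z. of_real (b z) * U z) y
     + of_real ((b y)\<^sup>2 * deriv b y / (1 - (b y)\<^sup>2)) * U y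
     + of_real (sqrt (1 - (b y)\<^sup>2)) * ddx W y"

definition W_flux :: "(real \<Rightarrow> complex) \<Rightarrow> (real \<Rightarrow> complex) \<Rightarrow> real \<Rightarrow> complex" where
  "W_flux U W y = ddx (\<lambda>z. of_real (sqrt (1 - (b z)\<^sup>2)) * U z) y
     + of_real (b y * deriv b y / sqrt (1 - (b y)\<^sup>2)) * U y
     - of_real (b y) * ddx W y"

lemma b_power2_less_1: "(b x)\<^sup>2 < 1"
  using b_less_1[of x] by (simp add: abs_square_less_1)

lemma s_pos: "s x > 0"
  using b_power2_less_1[of x] by (simp add: s_def)

lemma b_s_circle: "(b x)\<^sup>2 + (s x)\<^sup>2 = 1"
  using b_power2_less_1[of x] by (simp add: s_def)

lemma deriv_b_eq: "deriv b x = m x * (s x)\<^sup>2"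
  using b_power2_less_1[of x] by (simp add: s_def m_def)

lemma s_deriv: "(s has_real_derivative - (b x * m x * s x)) (at x within S)"
proof -
  have "(s has_real_derivative - (b x * deriv b x / s x)) (at x within S)"
    unfolding s_def[abs_def] using b_power2_less_1[of x]
    by (auto intro!: derivative_eq_intros b_deriv simp: field_simps)
  then show ?thesis
    using s_pos[of x] by (simp add: deriv_b_eq power2_eq_square mult.assoc)
qed

lemma continuous_on_b: "continuous_on S b"
  by (rule DERIV_continuous_on) (rule b_deriv)

lemma continuous_on_s: "continuous_on S s"
  by (rule DERIV_continuous_on) (rule s_deriv)

lemma continuous_on_m: "continuous_on S m"
  unfolding m_def[abs_def] using b_power2_less_1
  by (intro continuous_intros continuous_on_b continuous_deriv_b) (auto simp: less_imp_neq)

lemma ddx_real_mult: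
  assumes f: "(f has_real_derivative f') (at x)" and p: "p \<in> trig_polys N"
  shows "ddx (\<lambda>z. of_real (f z) * p z) x = of_real f' * p x + of_real (f x) * ddx p x"
proof -
  have "((\<lambda>z. f z *\<^sub>R p z) has_vector_derivative f x *\<^sub>R ddx p x + f' *\<^sub>R p x) (at x)"
    by (rule has_vector_derivative_scaleR[OF f trig_poly_derivative(1)[OF p]])
  then show ?thesis
    by (simp add: scaleR_conv_of_real vector_derivative_at add.commute)
qed

text \<open>The zeroth-order coefficients combine: \<open>b' + b\<^sup>2 b' / (1 - b\<^sup>2) = m\<close>, whereas in the second
  flux \<open>s' + b b' / s = 0\<close>.\<close>

lemma U_flux_eq:
  assumes U: "U \<in> trig_polys N"
  shows "U_flux U W x = of_real (m x) * U x + (of_real (b x) * ddx U x + of_real (s x) * ddx W x)"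
proof -
  have "deriv b x + (b x)\<^sup>2 * deriv b x / (1 - (b x)\<^sup>2) = m x"
    using b_power2_less_1[of x] by (simp add: m_def field_simps)
  then have "of_real (m x) * U x
      = of_real (deriv b x) * U x + of_real ((b x)\<^sup>2 * deriv b x / (1 - (b x)\<^sup>2)) * U x"
    by (simp only: flip: distrib_right of_real_add)
  then show ?thesis
    unfolding U_flux_def ddx_real_mult[OF b_deriv U] by (simp add: s_def)
qed

lemma W_flux_eq:
  assumes U: "U \<in> trig_polys N"
  shows "W_flux U W x = of_real (s x) * ddx U x - of_real (b x) * ddx W x"
proof -
  have "b x * deriv b x / s x = b x * m x * s x"
    using s_pos[of x] by (simp add: deriv_b_eq power2_eq_square)
  then show ?thesis
    unfolding W_flux_def ddx_real_mult[OF s_deriv U, unfolded s_def] s_def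
    by simp
qed

lemma continuous_on_flux:
  assumes U: "U \<in> trig_polys N" and W: "W \<in> trig_polys N"
  shows "continuous_on S (U_flux U W)" "continuous_on S (W_flux U W)"
proof -
  note cont = continuous_on_b continuous_on_s continuous_on_m continuous_on_trig_poly[OF U]
    continuous_on_trig_poly[OF trig_poly_derivative(2)[OF U]]
    continuous_on_trig_poly[OF trig_poly_derivative(2)[OF W]]
  show "continuous_on S (U_flux U W)"
    unfolding U_flux_eq[OF U, abs_def] by (intro continuous_intros cont)
  show "continuous_on S (W_flux U W)"
    unfolding W_flux_eq[OF U, abs_def] by (intro continuous_intros cont)
qed

text \<open>Subtracting the derivative of \<open>G = b/2 \<bar>U\<bar>\<^sup>2 + s U \<bullet> W - b/2 \<bar>W\<bar>\<^sup>2\<close>, the quadratic form of the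
  symmetric matrix with rows \<open>(b, s)\<close> and \<open>(s, -b)\<close>, removes every derivative of \<open>U\<close> and \<open>W\<close>
  from \<open>A\<^sub>1 \<bullet> U + A\<^sub>2 \<bullet> W\<close>. The remainder is \<open>m\<close> times a quadratic form with bounded coefficients.\<close>

lemma flux_inner_bound:
  assumes U: "U \<in> trig_polys N" and W: "W \<in> trig_polys N"
    and M: "\<And>x. x \<in> {0..2 * pi} \<Longrightarrow> \<bar>m x\<bar> \<le> M"
  shows "- (inner_L2 (U_flux U W) U + inner_L2 (W_flux U W) W)
    \<le> 2 * M * (inner_L2 U U + inner_L2 W W)"
proof -
  define G where "G x = b x / 2 * (U x \<bullet> U x) + s x * (U x \<bullet> W x) - b x / 2 * (W x \<bullet> W x)" for x
  define G' where "G' x = deriv b x / 2 * (U x \<bullet> U x) + b x * (U x \<bullet> ddx U x)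
     - b x * m x * s x * (U x \<bullet> W x) + s x * (ddx U x \<bullet> W x + U x \<bullet> ddx W x)
     - deriv b x / 2 * (W x \<bullet> W x) - b x * (W x \<bullet> ddx W x)" for x
  let ?h = "\<lambda>x. U_flux U W x \<bullet> U x + W_flux U W x \<bullet> W x"
  let ?E = "\<lambda>x. U x \<bullet> U x + W x \<bullet> W x"
  note cont = continuous_on_flux[OF U W] continuous_on_trig_poly[OF U] continuous_on_trig_poly[OF W]
  note vd = trig_poly_derivative(1)[OF U] trig_poly_derivative(1)[OF W]
  have inner: "((\<lambda>x. f x \<bullet> g x) has_real_derivative f x \<bullet> g' + f' \<bullet> g x) (at x within S)"
    if "(f has_vector_derivative f') (at x within S)" "(g has_vector_derivative g') (at x within S)"
    for f g :: "real \<Rightarrow> complex" and f' g' x S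
    using bounded_bilinear.has_vector_derivative[OF bounded_bilinear_inner that]
    by (simp add: has_real_derivative_iff_has_vector_derivative)
  have "(G has_real_derivative G' x) (at x within {0..2 * pi})" for x
    unfolding G_def[abs_def]
    by (rule DERIV_cong[OF DERIV_diff[OF DERIV_add[OF
              DERIV_mult[OF DERIV_cdivide[OF b_deriv] inner[OF vd(1) vd(1)]]
              DERIV_mult[OF s_deriv inner[OF vd(1) vd(2)]]]
            DERIV_mult[OF DERIV_cdivide[OF b_deriv] inner[OF vd(2) vd(2)]]]])
      (simp add: G'_def inner_commute algebra_simps)
  then have "(G' has_integral G (2 * pi) - G 0) {0..2 * pi}"
    by (intro fundamental_theorem_of_calculus) (auto simp: has_real_derivative_iff_has_vector_derivative)
  moreover have "G (2 * pi) = G 0"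
    using trig_poly_periodic[OF U, of 0] trig_poly_periodic[OF W, of 0]
    by (simp add: G_def s_def b_endpoints)
  ultimately have G': "(G' has_integral 0) {0..2 * pi}"
    by simp
  have h: "(?h has_integral inner_L2 (U_flux U W) U + inner_L2 (W_flux U W) W) {0..2 * pi}"
    unfolding inner_L2_def
    by (intro has_integral_add integrable_integral integrable_continuous_interval continuous_intros cont)
  have E: "((\<lambda>x. 2 * M * ?E x) has_integral 2 * M * (inner_L2 U U + inner_L2 W W)) {0..2 * pi}"
    unfolding inner_L2_def
    by (intro has_integral_mult_right has_integral_add integrable_integral
        integrable_continuous_interval continuous_intros cont)
  have "- (?h x - G' x) \<le> 2 * M * ?E x" if x: "x \<in> {0..2 * pi}" for x
  proof -
    let ?X = "U x \<bullet> U x" and ?Y = "U x \<bullet> W x" and ?Z = "W x \<bullet> W x"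
    have sq: "(s x)\<^sup>2 \<le> 1" "(b x)\<^sup>2 \<le> 1"
      using b_s_circle[of x] by (smt (verit) zero_le_power2)+
    have Y: "\<bar>?Y\<bar> \<le> (?X + ?Z) / 2"
    proof -
      have "0 \<le> (U x - W x) \<bullet> (U x - W x)" "0 \<le> (U x + W x) \<bullet> (U x + W x)"
        by (rule inner_ge_zero)+
      then show ?thesis
        by (simp add: inner_diff_left inner_diff_right inner_add_left inner_add_right
            inner_commute[of "W x" "U x"] abs_le_iff field_simps)
    qed
    have bs: "\<bar>b x * s x\<bar> \<le> 1"
      using sq b_less_1[of x] by (auto simp: abs_mult abs_square_le_1 intro!: mult_le_one)
    have "?h x - G' x = m x * ((1 - (s x)\<^sup>2 / 2) * ?X + b x * s x * ?Y + (s x)\<^sup>2 / 2 * ?Z)"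
      unfolding U_flux_eq[OF U] W_flux_eq[OF U] G'_def deriv_b_eq scaleR_conv_of_real[symmetric]
        inner_add_left inner_diff_left inner_scaleR_left
        inner_commute[of "ddx U x" "U x"] inner_commute[of "ddx W x" "W x"]
        inner_commute[of "ddx W x" "U x"]
      by (simp add: field_simps)
    also have "\<bar>\<dots>\<bar> \<le> M * (2 * ?E x)"
      unfolding abs_mult
    proof (rule mult_mono[OF M[OF x]])
      have "\<bar>b x * s x * ?Y\<bar> \<le> 1 * ((?X + ?Z) / 2)"
        unfolding abs_mult[of "b x * s x"] by (rule mult_mono[OF bs Y]) auto
      moreover have "0 \<le> (1 - (s x)\<^sup>2 / 2) * ?X" "0 \<le> (s x)\<^sup>2 / 2 * ?Z"
        using sq by (auto intro!: mult_nonneg_nonneg)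
      moreover have "(1 - (s x)\<^sup>2 / 2) * ?X \<le> 1 * ?X" "(s x)\<^sup>2 / 2 * ?Z \<le> 1 * ?Z"
        by (rule mult_right_mono; use sq in simp)+
      moreover have "\<bar>a + y + c\<bar> \<le> 2 * (X + Z)"
        if "\<bar>y\<bar> \<le> 1 * ((X + Z) / 2)" "0 \<le> a" "0 \<le> c" "a \<le> 1 * X" "c \<le> 1 * Z"
          "0 \<le> X" "0 \<le> Z" for a y c X Z :: real
        using that by (auto simp: abs_le_iff)
      ultimately show "\<bar>(1 - (s x)\<^sup>2 / 2) * ?X + b x * s x * ?Y + (s x)\<^sup>2 / 2 * ?Z\<bar> \<le> 2 * ?E x"
        using inner_ge_zero[of "U x"] inner_ge_zero[of "W x"] by blast
    qed (use M[OF x] in auto)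
    finally show ?thesis by (simp add: mult_ac)
  qed
  with has_integral_le[OF has_integral_neg[OF has_integral_diff[OF h G']] E] show ?thesis
    by simp
qed

text \<open>The vector \<open>(P, Q)\<close> of first-order parts is an orthogonal image of \<open>(U\<^sub>x, W\<^sub>x)\<close>, so their
  squared moduli have the same sum; the rest is Bernstein's inequality.\<close>

lemma flux_norm_bound:
  assumes U: "U \<in> trig_polys N" and W: "W \<in> trig_polys N"
    and M: "\<And>x. x \<in> {0..2 * pi} \<Longrightarrow> \<bar>m x\<bar> \<le> M"
  shows "inner_L2 (U_flux U W) (U_flux U W) + inner_L2 (W_flux U W) (W_flux U W)
    \<le> 2 * (M\<^sup>2 + (real N)\<^sup>2) * (inner_L2 U U + inner_L2 W W)"
proof -
  note cont = continuous_on_flux[OF U W] continuous_on_trig_poly[OF U] continuous_on_trig_poly[OF W]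
    continuous_on_trig_poly[OF trig_poly_derivative(2)[OF U]]
    continuous_on_trig_poly[OF trig_poly_derivative(2)[OF W]]
  let ?e = "\<lambda>V x. V x \<bullet> V x :: real"
  have lhs: "((\<lambda>x. ?e (U_flux U W) x + ?e (W_flux U W) x) has_integral
      inner_L2 (U_flux U W) (U_flux U W) + inner_L2 (W_flux U W) (W_flux U W)) {0..2 * pi}"
    unfolding inner_L2_def
    by (intro has_integral_add integrable_integral integrable_continuous_interval continuous_intros cont)
  have rhs: "((\<lambda>x. 2 * M\<^sup>2 * ?e U x + 2 * (?e (ddx U) x + ?e (ddx W) x)) has_integral
      2 * M\<^sup>2 * inner_L2 U U + 2 * (inner_L2 (ddx U) (ddx U) + inner_L2 (ddx W) (ddx W))) {0..2 * pi}"
    unfolding inner_L2_def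
    by (intro has_integral_mult_right has_integral_add integrable_integral
        integrable_continuous_interval continuous_intros cont)
  have "?e (U_flux U W) x + ?e (W_flux U W) x \<le> 2 * M\<^sup>2 * ?e U x + 2 * (?e (ddx U) x + ?e (ddx W) x)"
    if x: "x \<in> {0..2 * pi}" for x
  proof -
    define P where "P = b x *\<^sub>R ddx U x + s x *\<^sub>R ddx W x"
    define Q where "Q = s x *\<^sub>R ddx U x - b x *\<^sub>R ddx W x"
    have "P \<bullet> P + Q \<bullet> Q = ((b x)\<^sup>2 + (s x)\<^sup>2) * (?e (ddx U) x + ?e (ddx W) x)"
      by (simp add: P_def Q_def inner_add_left inner_add_right inner_diff_left inner_diff_right
          inner_commute[of "ddx W x" "ddx U x"] power2_eq_square algebra_simps)
    then have PQ: "P \<bullet> P + Q \<bullet> Q = ?e (ddx U) x + ?e (ddx W) x"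
      by (simp add: b_s_circle)
    \<comment> \<open>the parallelogram law, giving \<open>\<bar>m U + P\<bar>\<^sup>2 \<le> 2 \<bar>m U\<bar>\<^sup>2 + 2 \<bar>P\<bar>\<^sup>2\<close>\<close>
    have "0 \<le> (m x *\<^sub>R U x - P) \<bullet> (m x *\<^sub>R U x - P)"
      by (rule inner_ge_zero)
    then have "(m x *\<^sub>R U x + P) \<bullet> (m x *\<^sub>R U x + P) \<le> 2 * ((m x)\<^sup>2 * ?e U x) + 2 * (P \<bullet> P)"
      by (simp add: inner_add_left inner_add_right inner_diff_left inner_diff_right
          inner_commute[of P "U x"] power2_eq_square algebra_simps)
    moreover have "(m x)\<^sup>2 * ?e U x \<le> M\<^sup>2 * ?e U x"
      using M[OF x] by (intro mult_right_mono) (auto simp: abs_le_square_iff[symmetric])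
    moreover have "U_flux U W x = m x *\<^sub>R U x + P" "W_flux U W x = Q"
      unfolding U_flux_eq[OF U] W_flux_eq[OF U] P_def Q_def scaleR_conv_of_real by auto
    moreover have "p + q \<le> 2 * c + 2 * d"
      if "p \<le> 2 * a + 2 * r" "a \<le> c" "r + q = d" "0 \<le> q" for p q r a c d :: real
      using that by linarith
    ultimately show ?thesis
      using PQ inner_ge_zero[of Q] by (simp only: mult.assoc)
  qed
  from has_integral_le[OF lhs rhs this]
  have "inner_L2 (U_flux U W) (U_flux U W) + inner_L2 (W_flux U W) (W_flux U W)
    \<le> 2 * M\<^sup>2 * inner_L2 U U + 2 * (inner_L2 (ddx U) (ddx U) + inner_L2 (ddx W) (ddx W))"
    by simp
  also have "\<dots> \<le> 2 * M\<^sup>2 * (inner_L2 U U + inner_L2 W W)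
      + 2 * ((real N)\<^sup>2 * inner_L2 U U + (real N)\<^sup>2 * inner_L2 W W)"
    using trig_poly_derivative(3)[OF U] trig_poly_derivative(3)[OF W] inner_L2_nonneg[of W]
    by (intro add_mono mult_left_mono) auto
  finally show ?thesis
    by (simp add: algebra_simps)
qed

text \<open>The factor \<open>r\<close> stands for \<open>\<Delta>t / \<epsilon>\<close>: uniformity in \<open>\<epsilon>\<close> is the absence of \<open>r\<close> from the
  growth factor. That factor combines \<open>2 \<Delta>t \<cdot> 2 M\<close> from the energy production of the fluxes with
  \<open>\<Delta>t\<^sup>2 \<cdot> 2 (M\<^sup>2 + N\<^sup>2) \<le> \<Delta>t \<cdot> 2 (M\<^sup>2 + c)\<close> from their size.\<close>

lemma imex_step_energy:
  assumes polys: "U \<in> trig_polys N" "W \<in> trig_polys N" "W' \<in> trig_polys N"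
    and M: "\<And>x. x \<in> {0..2 * pi} \<Longrightarrow> \<bar>m x\<bar> \<le> M"
    and \<sigma>: "continuous_on {0..2 * pi} \<sigma>" "\<And>x. x \<in> {0..2 * pi} \<Longrightarrow> 0 \<le> \<sigma> x"
    and dt: "0 \<le> dt" "dt \<le> 1" "dt * (real N)\<^sup>2 \<le> c" and r: "0 \<le> r"
    and U': "\<And>x. U' x - U x + of_real dt * fourier_proj N (U_flux U W) x = 0"
    and W': "\<And>x. W' x - W x + of_real dt * fourier_proj N (W_flux U W) x
               = - of_real r * fourier_proj N (\<lambda>y. of_real (\<sigma> y) * W' y) x"
  shows "inner_L2 U' U' + inner_L2 W' W'
    \<le> (1 + dt * (4 * M + 2 * M\<^sup>2 + 2 * c)) * (inner_L2 U U + inner_L2 W W)"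
proof -
  let ?E = "inner_L2 U U + inner_L2 W W"
  \<comment> \<open>the explicit part of the update of \<open>W\<close>\<close>
  define V where "V x = W' x + of_real r * fourier_proj N (\<lambda>y. of_real (\<sigma> y) * W' y) x" for x
  have V: "V x = W x - of_real dt * fourier_proj N (W_flux U W) x" for x
    using W'[of x] by (simp add: V_def algebra_simps eq_neg_iff_add_eq_0)
  have "V \<in> trig_polys N"
  proof -
    obtain d where d: "\<And>x. W x = (\<Sum>k\<in>{- int N..int N}. d k * fourier_mode k x)"
      using polys(2) by (auto simp: trig_polys_def)
    show ?thesis
      unfolding trig_polys_def
      by (rule CollectI, rule exI[of _ "\<lambda>k. d k - of_real dt * fourier_coeff (W_flux U W) k"])
        (simp add: V d fourier_proj_def sum_distrib_left sum_subtractf algebra_simps)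
  qed
  then have "inner_L2 W' W' \<le> inner_L2 V V"
    using implicit_damping_energy[OF polys(3) _ r \<sigma> V_def] by simp
  also have "\<dots> \<le> inner_L2 W W - 2 * dt * inner_L2 (W_flux U W) W
      + dt\<^sup>2 * inner_L2 (W_flux U W) (W_flux U W)"
    by (rule projected_euler_energy[OF polys(2) continuous_on_flux(2)[OF polys(1,2)] V])
  finally have W'_le: "inner_L2 W' W' \<le> \<dots>" .
  have "U' x = U x - of_real dt * fourier_proj N (U_flux U W) x" for x
    using U'[of x] by (simp add: algebra_simps eq_neg_iff_add_eq_0)
  from projected_euler_energy[OF polys(1) continuous_on_flux(1)[OF polys(1,2)] this] W'_le
  have "inner_L2 U' U' + inner_L2 W' W' \<le> ?E
      + 2 * dt * - (inner_L2 (U_flux U W) U + inner_L2 (W_flux U W) W)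
      + dt\<^sup>2 * (inner_L2 (U_flux U W) (U_flux U W) + inner_L2 (W_flux U W) (W_flux U W))"
    by (simp add: algebra_simps)
  also have "\<dots> \<le> ?E + 2 * dt * (2 * M * ?E) + dt\<^sup>2 * (2 * (M\<^sup>2 + (real N)\<^sup>2) * ?E)"
    using dt flux_inner_bound[OF polys(1,2) M] flux_norm_bound[OF polys(1,2) M]
    by (intro add_mono mult_left_mono) auto
  also have "dt\<^sup>2 * (2 * (M\<^sup>2 + (real N)\<^sup>2) * ?E) \<le> dt * (2 * (M\<^sup>2 + c)) * ?E"
  proof -
    have "dt * M\<^sup>2 \<le> M\<^sup>2"
      using dt by (intro mult_left_le_one_le) auto
    then have "dt * (2 * (dt * M\<^sup>2 + dt * (real N)\<^sup>2)) * ?E \<le> dt * (2 * (M\<^sup>2 + c)) * ?E"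
      using dt inner_L2_nonneg[of U] inner_L2_nonneg[of W]
      by (intro mult_right_mono mult_left_mono add_mono) auto
    then show ?thesis by (simp add: power2_eq_square algebra_simps)
  qed
  finally show ?thesis
    by (simp add: algebra_simps)
qed

end

section \<open>Stability\<close>

text \<open>Only values on one period are bounded by hypothesis, but the product rule needs
  \<open>1 - b\<^sup>2 > 0\<close> in a neighbourhood of the end points as well.\<close>

lemma periodic_2pi_transfer:
  fixes f :: "real \<Rightarrow> 'a"
  assumes f: "periodic_2pi f" and P: "\<And>x. x \<in> {0..2 * pi} \<Longrightarrow> P (f x)"
  shows "P (f x)"
proof -
  have shift: "f (y + real n * (2 * pi)) = f y" for y n
  proof (induction n)
    case (Suc n)
    have "f (y + real (Suc n) * (2 * pi)) = f ((y + real n * (2 * pi)) + 2 * pi)"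
      by (simp add: algebra_simps)
    also have "\<dots> = f y"
      using f Suc by (simp add: periodic_2pi_def)
    finally show ?case .
  qed simp
  define k where "k = \<lfloor>x / (2 * pi)\<rfloor>"
  define y where "y = x - of_int k * (2 * pi)"
  have "of_int k \<le> x / (2 * pi)" "x / (2 * pi) \<le> of_int k + 1"
    unfolding k_def by linarith+
  then have "y \<in> {0..2 * pi}"
    by (auto simp: y_def field_simps)
  moreover have "f x = f y"
  proof (cases "k \<ge> 0")
    case True
    then show ?thesis using shift[of y "nat k"] by (simp add: y_def)
  next
    case False
    then show ?thesis using shift[of x "nat (- k)"] by (simp add: y_def algebra_simps)
  qed
  ultimately show ?thesis using P by simp
qed

lemma smooth_fun_DERIV:
  assumes "smooth_fun f"
  shows "(f has_real_derivative deriv f x) (at x within S)" and "continuous_on S (deriv f)"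
proof -
  have "f differentiable (at x)" "deriv f differentiable (at x)" for x
    using assms[unfolded smooth_fun_def, rule_format, of 0 x]
      assms[unfolded smooth_fun_def, rule_format, of 1 x] by simp_all
  then show "(f has_real_derivative deriv f x) (at x within S)" "continuous_on S (deriv f)"
    by (auto intro: has_field_derivative_at_within continuous_at_imp_continuous_on
        differentiable_imp_continuous_within
        simp: DERIV_deriv_iff_real_differentiable)
qed

theorem theorem4p2:
  fixes b \<sigma> :: "real \<Rightarrow> real"
    and b\<^sub>1 \<sigma>\<^sub>0 \<sigma>\<^sub>1 T c_CFL :: real
  assumes "smooth_fun b" and "periodic_2pi b"
    and "smooth_fun \<sigma>" and "periodic_2pi \<sigma>"
    and "\<And>x. x \<in> {0..2 * pi} \<Longrightarrow> \<bar>b x\<bar> \<le> b\<^sub>1" and "b\<^sub>1 < 1"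
    and "0 < \<sigma>\<^sub>0"
    and "\<And>x. x \<in> {0..2 * pi} \<Longrightarrow> \<sigma>\<^sub>0 \<le> \<sigma> x \<and> \<sigma> x \<le> \<sigma>\<^sub>1"
    and "c_CFL > 0"
  shows "\<exists>C::real. \<forall>T\<^sub>0 \<epsilon> dt :: real. \<forall>N::nat. \<forall>U W :: nat \<Rightarrow> real \<Rightarrow> complex.
           0 \<le> T\<^sub>0 \<longrightarrow> T\<^sub>0 \<le> T \<longrightarrow> \<epsilon> > 0 \<longrightarrow> N \<ge> 1 \<longrightarrow>
           dt > 0 \<longrightarrow> dt \<le> min (c_CFL / (real N)\<^sup>2) 1 \<longrightarrow>
           imex_bdf1_solution b \<sigma> \<epsilon> dt N U W \<longrightarrow>
           (\<forall>n::nat. T\<^sub>0 + real n * dt \<le> T \<longrightarrow>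
              (norm_L2 (U n))\<^sup>2 + (norm_L2 (W n))\<^sup>2
                \<le> C * ((norm_L2 (U 0))\<^sup>2 + (norm_L2 (W 0))\<^sup>2))"
proof -
  interpret subcharacteristic b
  proof
    show "\<bar>b x\<bar> < 1" for x
    proof (rule periodic_2pi_transfer[OF assms(2), of "\<lambda>z. \<bar>z\<bar> < 1"])
      show "\<bar>b x\<bar> < 1" if "x \<in> {0..2 * pi}" for x
        using assms(5)[OF that] assms(6) by linarith
    qed
    show "b (2 * pi) = b 0"
      using assms(2)[unfolded periodic_2pi_def, rule_format, of 0] by simp
  qed (rule smooth_fun_DERIV[OF assms(1)])+
  have "bounded (m ` {0..2 * pi})"
    by (intro compact_imp_bounded compact_continuous_image continuous_on_m compact_Icc)
  then obtain M where M: "\<And>x. x \<in> {0..2 * pi} \<Longrightarrow> \<bar>m x\<bar> \<le> M"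
    unfolding bounded_iff real_norm_def by blast
  have "M \<ge> 0"
    using M[of 0] by simp
  have \<sigma>: "continuous_on {0..2 * pi} \<sigma>"
    by (rule DERIV_continuous_on) (rule smooth_fun_DERIV(1)[OF assms(3)])
  have \<sigma>_nonneg: "0 \<le> \<sigma> x" if "x \<in> {0..2 * pi}" for x
    using assms(7) assms(8)[OF that] by linarith
  define K where "K = 4 * M + 2 * M\<^sup>2 + 2 * c_CFL"
  have "K \<ge> 0"
    using \<open>M \<ge> 0\<close> assms(9) by (simp add: K_def)
  show ?thesis
  \<comment> \<open>The number of steps satisfies \<open>n \<Delta>t \<le> T - T\<^sub>0 \<le> T\<close>.\<close>
  proof (intro exI[of _ "exp (K * T)"] allI impI)
    fix T\<^sub>0 \<epsilon> dt :: real and N :: nat and U W :: "nat \<Rightarrow> real \<Rightarrow> complex" and n :: nat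
    assume "0 \<le> T\<^sub>0" "T\<^sub>0 \<le> T" "\<epsilon> > 0" "N \<ge> 1" "dt > 0" and dt_le: "dt \<le> min (c_CFL / (real N)\<^sup>2) 1"
      and sol: "imex_bdf1_solution b \<sigma> \<epsilon> dt N U W" and n: "T\<^sub>0 + real n * dt \<le> T"
    define E where "E k = inner_L2 (U k) (U k) + inner_L2 (W k) (W k)" for k
    have E_nonneg: "E k \<ge> 0" for k
      using inner_L2_nonneg[of "U k"] inner_L2_nonneg[of "W k"] by (simp add: E_def)
    have step: "E (Suc k) \<le> (1 + dt * K) * E k" for k
      unfolding E_def K_def
    proof (rule imex_step_energy[where N = N and \<sigma> = \<sigma> and r = "dt / \<epsilon>"])
      show "dt * (real N)\<^sup>2 \<le> c_CFL"
        using dt_le \<open>N \<ge> 1\<close> by (simp add: pos_le_divide_eq)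
    qed (use sol dt_le \<open>dt > 0\<close> \<open>\<epsilon> > 0\<close> M \<sigma> \<sigma>_nonneg in
        \<open>auto simp: imex_bdf1_solution_def U_flux_def[abs_def] W_flux_def[abs_def]\<close>)
    have "E n \<le> exp (dt * K) ^ n * E 0" for n
    proof (induction n)
      case (Suc n)
      have "E (Suc n) \<le> exp (dt * K) * E n"
        using step[of n] mult_right_mono[OF exp_ge_add_one_self[of "dt * K"] E_nonneg[of n]] by linarith
      also have "\<dots> \<le> exp (dt * K) * (exp (dt * K) ^ n * E 0)"
        using Suc by simp
      finally show ?case by simp
    qed simp
    also have "exp (dt * K) ^ n = exp (K * (real n * dt))"
      by (simp add: exp_of_nat_mult[symmetric] mult_ac)
    also have "\<dots> * E 0 \<le> exp (K * T) * E 0"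
      using n \<open>0 \<le> T\<^sub>0\<close> \<open>K \<ge> 0\<close> E_nonneg[of 0] by (auto intro!: mult_right_mono mult_left_mono)
    finally show "(norm_L2 (U n))\<^sup>2 + (norm_L2 (W n))\<^sup>2
        \<le> exp (K * T) * ((norm_L2 (U 0))\<^sup>2 + (norm_L2 (W 0))\<^sup>2)"
      by (simp add: E_def norm_L2_power2)
  qed
qed

end
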